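(* Let $c$ be a circuit, $st_0$ an initial state, and $RD_c$ the rise-decoupled marked graph of $c$. Then $RD_c$ ensures flow equivalence of $c$ with initial state $st_0$. Explicitly: for every trace $t$ such that $RD_c\vdash t\Downarrow m$ for some marking $m$, every latch $l$ with $\mathrm{transp}(t,l)=\mathrm{Opaque}$, and every value $v$ with $\langle c,st_0\rangle\vdash t\downarrow l\mapsto v$, we have $v=\mathrm{sync}(c,st_0,\mathrm{num}(l-,t))(l)$.
   Context: A value is either $\mathrm{Num}(n)$ with $n\in\mathbb N$ or the undefined value $X$. A circuit $c$ consists of: a set of even latches and a set of odd latches (the latches of $c$ are their disjoint union); a finite list of pairs $(E,O)$ with $E$ even, $O$ odd, and a finite list of pairs $(O,E)$ with $O$ odd, $E$ even, where a pair $(l,l')$ in either list means $l$ is a left neighbor of $l'$ (and $l'$ a right neighbor of $l$); and for each latch $l$ a next-state function mapping an assignment of values to the left neighbors of $l$ to a value. A state is a function from latches to values; for a state $st$, $\mathrm{next}_c(st,l)$ denotes the next-state function of $l$ applied to the restriction of $st$ to the left neighbors of $l$. Synchronous execution: for an initial state $st_0$ and $n\in\mathbb N$, $\mathrm{sync}(c,st_0,n)(l)$ equals $st_0(l)$ if $n=0$ and $l$ even; $X$ if $n=0$ and $l$ odd; $\mathrm{next}_c(\mathrm{sync}(c,st_0,n),l)$ if $n>0$ and $l$ even; $\mathrm{next}_c(\mathrm{sync}(c,st_0,n-1),l)$ if $n>0$ and $l$ odd. Events are $l+$ (rise of the clock of latch $l$) and $l-$ (fall). A trace is a finite sequence of events;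 $\varepsilon$ is the empty trace and $t\triangleright e$ is $t$ extended by event $e$ as its most recent event. $\mathrm{num}(e,t)$ is the number of occurrences of $e$ in $t$. Transparency: $\mathrm{transp}(\varepsilon,l)=\mathrm{Transparent}$ if $l$ odd, $\mathrm{Opaque}$ if $l$ even; $\mathrm{transp}(t\triangleright l+,l)=\mathrm{Transparent}$; $\mathrm{transp}(t\triangleright l-,l)=\mathrm{Opaque}$; $\mathrm{transp}(t\triangleright e,l)=\mathrm{transp}(t,l)$ for other events $e$. Asynchronous execution: $\langle c,st_0\rangle\vdash t\downarrow l\mapsto v$ is the smallest relation on (trace, latch, value) closed under: (1) if $\mathrm{transp}(t,l)=\mathrm{Transparent}$ and $st$ is a state such that $\langle c,st_0\rangle\vdash t\downarrow l'\mapsto st(l')$ for every left neighbor $l'$ of $l$, then $\langle c,st_0\rangle\vdash t\downarrow l\mapsto \mathrm{next}_c(st,l)$; (2) for every even $l$, $\langle c,st_0\rangle\vdash \varepsilon\downarrow l\mapsto st_0(l)$; (3) if $\mathrm{transp}(t'\triangleright e,l)=\mathrm{Opaque}$, $e\neq l-$, and $\langle c,st_0\rangle\vdash t'\downarrow l\mapsto v$ with $\mathrm{transp}(t',l)=\mathrm{Opaque}$, then $\langle c,st_0\rangle\vdash t'\triangleright e\downarrow l\mapsto v$; (4) if $st$ is a state with $\langle c,st_0\rangle\vdash t'\downarrow l'\mapsto st(l')$ for every left neighbor $l'$ of $l$, then $\langle c,st_0\rangle\vdash t'\triangleright l-\downarrow l\mapsto \mathrm{next}_c(st,l)$. A marked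 graph over the set of events consists of a set of places, each with a unique input event and a unique output event, and an initial marking $m_0$ (places $\to\mathbb N$). An event $e$ is enabled in a marking $m$ if $m(p)>0$ for every place $p$ with output event $e$; firing $e$ yields $m'$ with $m'(p)=m(p)-1$ if $p$'s output event is $e$, $m(p)+1$ if $p$'s input event is $e$, $m(p)$ otherwise. $M\vdash t\Downarrow m$ is defined inductively: $M\vdash\varepsilon\Downarrow m_0$; if $M\vdash t'\Downarrow m'$ and $e$ is enabled in $m'$, then $M\vdash t'\triangleright e\Downarrow m$ with $m$ the result of firing $e$ in $m'$. A marked graph $M$ ensures flow equivalence of $c$ with initial state $st_0$ if for all latches $l$, traces $t$ and values $v$: if $M\vdash t\Downarrow m$ for some $m$, $\mathrm{transp}(t,l)=\mathrm{Opaque}$ and $\langle c,st_0\rangle\vdash t\downarrow l\mapsto v$, then $v=\mathrm{sync}(c,st_0,\mathrm{num}(l-,t))(l)$. The rise-decoupled marked graph $RD_c$ has places (input $\to$ output) with initial markings: for each latch $l$, a place $l+\to l-$ with initial marking $1$ if $l$ odd, $0$ if $l$ even, and a place $l-\to l+$ with initial marking $1$ if $l$ even, $0$ if $l$ odd; for each neighbor pair $(l,l')$ ($l$ a left neighbor of $l'$), a place $l-\to l'-$ with initial marking $1$ if $l$ even, $0$ if $l$ odd, and a place $l'-\to l+$ with initial marking $0$. *)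

theory Defs
  imports Main "HOL-Library.FuncSet"
begin

datatype val = Num nat | X

datatype ('e, 'o) latch = is_Even: Even 'e | is_Odd: Odd 'o

type_synonym ('e, 'o) state = "('e, 'o) latch \<Rightarrow> val"

text \<open>
  The latch sets are carriers and may be empty, a proper subset of the type, or infinite.
  The next-state function of a latch is only ever applied to assignments that are
  restricted (in the sense of \<^const>\<open>restrict\<close>) to its left neighbors.
\<close>

record ('e, 'o) circuit =
  even_latches :: "'e set"
  odd_latches :: "'o set"
  even_odd :: "('e \<times> 'o) list"
  odd_even :: "('o \<times> 'e) list"
  next_fun :: "('e, 'o) latch \<Rightarrow> ('e, 'o) state \<Rightarrow> val"

definition wf_circuit :: "('e, 'o) circuit \<Rightarrow> bool" where
  "wf_circuit c \<longleftrightarrow>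
     set (even_odd c) \<subseteq> even_latches c \<times> odd_latches c \<and>
     set (odd_even c) \<subseteq> odd_latches c \<times> even_latches c"

definition latches :: "('e, 'o) circuit \<Rightarrow> ('e, 'o) latch set" where
  "latches c = Even ` even_latches c \<union> Odd ` odd_latches c"

text \<open>A pair \<open>(l, l')\<close> in this set means that \<open>l\<close> is a left neighbor of \<open>l'\<close>.\<close>

definition neighbors :: "('e, 'o) circuit \<Rightarrow> (('e, 'o) latch \<times> ('e, 'o) latch) set" where
  "neighbors c =
     {(Even a, Odd b) | a b. (a, b) \<in> set (even_odd c)} \<union>
     {(Odd b, Even a) | a b. (b, a) \<in> set (odd_even c)}"

definition left_neighbors :: "('e, 'o) circuit \<Rightarrow> ('e, 'o) latch \<Rightarrow> ('e, 'o) latch set" where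
  "left_neighbors c l = {l'. (l', l) \<in> neighbors c}"

definition next_state :: "('e, 'o) circuit \<Rightarrow> ('e, 'o) state \<Rightarrow> ('e, 'o) latch \<Rightarrow> val" where
  "next_state c st l = next_fun c l (restrict st (left_neighbors c l))"

lemma next_state_cong [fundef_cong]:
  assumes "c = c'" "l = l'" "\<And>k. k \<in> left_neighbors c' l' \<Longrightarrow> st k = st' k"
  shows "next_state c st l = next_state c' st' l'"
proof -
  have "restrict st (left_neighbors c l) = restrict st' (left_neighbors c' l')"
    using assms by (auto simp: restrict_def)
  then show ?thesis
    using assms by (simp add: next_state_def)
qed

function sync :: "('e, 'o) circuit \<Rightarrow> ('e, 'o) state \<Rightarrow> nat \<Rightarrow> ('e, 'o) latch \<Rightarrow> val" where
  "sync c st0 0 (Even a) = st0 (Even a)"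
| "sync c st0 0 (Odd b) = X"
| "sync c st0 (Suc n) (Even a) = next_state c (\<lambda>l. sync c st0 (Suc n) l) (Even a)"
| "sync c st0 (Suc n) (Odd b) = next_state c (\<lambda>l. sync c st0 n l) (Odd b)"
  by pat_completeness auto
termination
  by (relation "measure (\<lambda>(c, st0, n, l). 2 * n + (if is_Even l then 1 else 0))")
     (auto simp: left_neighbors_def neighbors_def)

datatype 'l event = Rise 'l | Fall 'l

definition events :: "('e, 'o) circuit \<Rightarrow> ('e, 'o) latch event set" where
  "events c = Rise ` latches c \<union> Fall ` latches c"

text \<open>Traces are lists with the most recent event at the head.\<close>

type_synonym 'ev trace = "'ev list"

abbreviation snoc_event :: "'ev trace \<Rightarrow> 'ev \<Rightarrow> 'ev trace"  (infixl "\<triangleright>" 66) where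
  "t \<triangleright> e \<equiv> e # t"

definition traces :: "('e, 'o) circuit \<Rightarrow> ('e, 'o) latch event trace set" where
  "traces c = lists (events c)"

abbreviation num :: "'ev \<Rightarrow> 'ev trace \<Rightarrow> nat" where
  "num e t \<equiv> count_list t e"

datatype transparency = Transparent | Opaque

fun transp :: "('e, 'o) latch event trace \<Rightarrow> ('e, 'o) latch \<Rightarrow> transparency" where
  "transp [] l = (if is_Odd l then Transparent else Opaque)"
| "transp (t \<triangleright> e) l =
     (if e = Rise l then Transparent else if e = Fall l then Opaque else transp t l)"

inductive async ::
  "('e, 'o) circuit \<Rightarrow> ('e, 'o) state \<Rightarrow>
   ('e, 'o) latch event trace \<Rightarrow> ('e, 'o) latch \<Rightarrow> val \<Rightarrow> bool"
  for c :: "('e, 'o) circuit" and st0 :: "('e, 'o) state" where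
  async_transparent:
    "\<lbrakk>t \<in> traces c; l \<in> latches c; transp t l = Transparent;
      \<forall>l' \<in> left_neighbors c l. async c st0 t l' (st l')\<rbrakk>
     \<Longrightarrow> async c st0 t l (next_state c st l)"
| async_init:
    "a \<in> even_latches c \<Longrightarrow> async c st0 [] (Even a) (st0 (Even a))"
| async_opaque:
    "\<lbrakk>e \<in> events c; transp (t \<triangleright> e) l = Opaque; e \<noteq> Fall l;
      async c st0 t l v; transp t l = Opaque\<rbrakk>
     \<Longrightarrow> async c st0 (t \<triangleright> e) l v"
| async_fall:
    "\<lbrakk>t \<in> traces c; l \<in> latches c;
      \<forall>l' \<in> left_neighbors c l. async c st0 t l' (st l')\<rbrakk>
     \<Longrightarrow> async c st0 (t \<triangleright> Fall l) l (next_state c st l)"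

record ('ev, 'p) marked_graph =
  mg_events :: "'ev set"
  places :: "'p set"
  input_event :: "'p \<Rightarrow> 'ev"
  output_event :: "'p \<Rightarrow> 'ev"
  init_marking :: "'p \<Rightarrow> nat"

definition wf_marked_graph :: "('ev, 'p) marked_graph \<Rightarrow> bool" where
  "wf_marked_graph M \<longleftrightarrow>
     (\<forall>p \<in> places M. input_event M p \<in> mg_events M \<and> output_event M p \<in> mg_events M)"

definition enabled :: "('ev, 'p) marked_graph \<Rightarrow> ('p \<Rightarrow> nat) \<Rightarrow> 'ev \<Rightarrow> bool" where
  "enabled M m e \<longleftrightarrow> (\<forall>p \<in> places M. output_event M p = e \<longrightarrow> m p > 0)"

text \<open>Values of a marking outside \<^const>\<open>places\<close> are irrelevant.\<close>

definition fire :: "('ev, 'p) marked_graph \<Rightarrow> 'ev \<Rightarrow> ('p \<Rightarrow> nat) \<Rightarrow> ('p \<Rightarrow> nat)" where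
  "fire M e m = (\<lambda>p.
     if output_event M p = e then m p - 1
     else if input_event M p = e then m p + 1
     else m p)"

inductive mg_run :: "('ev, 'p) marked_graph \<Rightarrow> 'ev trace \<Rightarrow> ('p \<Rightarrow> nat) \<Rightarrow> bool"
  for M :: "('ev, 'p) marked_graph" where
  mg_run_empty: "mg_run M [] (init_marking M)"
| mg_run_step:
    "\<lbrakk>mg_run M t m; e \<in> mg_events M; enabled M m e\<rbrakk> \<Longrightarrow> mg_run M (t \<triangleright> e) (fire M e m)"

definition ensures_flow_equivalence ::
  "(('e, 'o) latch event, 'p) marked_graph \<Rightarrow> ('e, 'o) circuit \<Rightarrow> ('e, 'o) state \<Rightarrow> bool" where
  "ensures_flow_equivalence M c st0 \<longleftrightarrow>
     (\<forall>l \<in> latches c. \<forall>t \<in> traces c. \<forall>v.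
        (\<exists>m. mg_run M t m) \<longrightarrow> transp t l = Opaque \<longrightarrow> async c st0 t l v \<longrightarrow>
        v = sync c st0 (num (Fall l) t) l)"

text \<open>
  For a neighbor pair \<open>(l, l')\<close>, \<open>Fall_Fall l l'\<close> is the place from \<open>Fall l\<close> to
  \<open>Fall l'\<close>, and \<open>Fall_RiseL l l'\<close> is the place from \<open>Fall l'\<close> back to \<open>Rise l\<close>.
\<close>

datatype 'l rd_place =
    Rise_Fall 'l
  | Fall_Rise 'l
  | Fall_Fall 'l 'l
  | Fall_RiseL 'l 'l

fun rd_input :: "'l rd_place \<Rightarrow> 'l event" where
  "rd_input (Rise_Fall l) = Rise l"
| "rd_input (Fall_Rise l) = Fall l"
| "rd_input (Fall_Fall l l') = Fall l"
| "rd_input (Fall_RiseL l l') = Fall l'"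

fun rd_output :: "'l rd_place \<Rightarrow> 'l event" where
  "rd_output (Rise_Fall l) = Fall l"
| "rd_output (Fall_Rise l) = Rise l"
| "rd_output (Fall_Fall l l') = Fall l'"
| "rd_output (Fall_RiseL l l') = Rise l"

fun rd_init :: "('e, 'o) latch rd_place \<Rightarrow> nat" where
  "rd_init (Rise_Fall l) = (if is_Odd l then 1 else 0)"
| "rd_init (Fall_Rise l) = (if is_Even l then 1 else 0)"
| "rd_init (Fall_Fall l l') = (if is_Even l then 1 else 0)"
| "rd_init (Fall_RiseL l l') = 0"

definition RD ::
  "('e, 'o) circuit \<Rightarrow> (('e, 'o) latch event, ('e, 'o) latch rd_place) marked_graph" where
  "RD c =
     \<lparr> mg_events = events c,
       places =
         Rise_Fall ` latches c \<union> Fall_Rise ` latches c \<union>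
         {Fall_Fall l l' | l l'. (l, l') \<in> neighbors c} \<union>
         {Fall_RiseL l l' | l l'. (l, l') \<in> neighbors c},
       input_event = rd_input,
       output_event = rd_output,
       init_marking = rd_init \<rparr>"

lemma wf_marked_graph_RD:
  assumes "wf_circuit c"
  shows "wf_marked_graph (RD c)"
  using assms
  by (auto simp: wf_circuit_def wf_marked_graph_def RD_def events_def latches_def neighbors_def)

end

(* In a run of the rise-decoupled marked graph, the token counts of the places express linear
   relations between the numbers of rises and falls.  They force that, whenever l falls for the
   (k+1)-st time, every left neighbor of l is opaque and has fallen exactly k times (l odd) or k+1
   times (l even).  These are the indices at which the recursion of sync reads the left neighbors,
   so the values agree by induction on the asynchronous execution; the values of transparent
   latches are never needed. *)

theory Submission imports Defs begin

lemma mg_run_ConsE: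
  assumes "mg_run M (e # t) m"
  obtains m' where "mg_run M t m'" "enabled M m' e" "m = fire M e m'"
  using assms by (cases rule: mg_run.cases) auto

text \<open>Enabledness keeps the truncated subtraction in \<open>fire\<close> exact. Self-loops are
  excluded because \<open>fire\<close> would only decrement them.\<close>

lemma mg_run_token_count:
  assumes "mg_run M t m" "p \<in> places M" "input_event M p \<noteq> output_event M p"
  shows "m p + num (output_event M p) t = init_marking M p + num (input_event M p) t"
  using assms by induction (auto simp: fire_def enabled_def)

context
  fixes c :: "('e, 'o) circuit" and t :: "('e, 'o) latch event trace"
    and m :: "('e, 'o) latch rd_place \<Rightarrow> nat"
  assumes run: "mg_run (RD c) t m"
begin

lemma RD_Rise_Fall_count:
  assumes "l \<in> latches c"
  shows "m (Rise_Fall l) + num (Fall l) t = of_bool (is_Odd l) + num (Rise l) t"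
  using mg_run_token_count[OF run, of "Rise_Fall l"] assms by (simp add: RD_def)

lemma RD_Fall_Rise_count:
  assumes "l \<in> latches c"
  shows "m (Fall_Rise l) + num (Rise l) t = of_bool (is_Even l) + num (Fall l) t"
  using mg_run_token_count[OF run, of "Fall_Rise l"] assms by (simp add: RD_def)

lemma RD_Fall_Fall_count:
  assumes "(l, l') \<in> neighbors c"
  shows "m (Fall_Fall l l') + num (Fall l') t = of_bool (is_Even l) + num (Fall l) t"
  using mg_run_token_count[OF run, of "Fall_Fall l l'"] assms
  \<comment> \<open>Neighbors have opposite parity, so the place is no self-loop.\<close>
  by (auto simp: RD_def neighbors_def)

lemma RD_Fall_RiseL_count:
  assumes "(l, l') \<in> neighbors c"
  shows "m (Fall_RiseL l l') + num (Rise l) t = num (Fall l') t"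
  using mg_run_token_count[OF run, of "Fall_RiseL l l'"] assms
  by (auto simp: RD_def)

end

lemma latch_parity: "is_Even l \<longleftrightarrow> \<not> is_Odd l"
  by (cases l) auto

text \<open>\<open>Rise_Fall l\<close> and \<open>Fall_Rise l\<close> together always hold one
  token, so rises and falls of \<open>l\<close> alternate, and \<open>l\<close> is opaque exactly
  when \<open>Rise_Fall l\<close> is empty.\<close>

lemma RD_opaque_iff:
  assumes "mg_run (RD c) t m" "l \<in> latches c"
  shows "transp t l = Opaque \<longleftrightarrow> num (Fall l) t = num (Rise l) t + of_bool (is_Odd l)"
  using assms(1)
proof induction
  case mg_run_empty
  then show ?case by simp
next
  case (mg_run_step t m e)
  note counts = RD_Rise_Fall_count[OF mg_run_step(1) assms(2)]
    RD_Fall_Rise_count[OF mg_run_step(1) assms(2)]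
  have "m (Fall_Rise l) > 0" if "e = Rise l"
    using mg_run_step(3) that assms(2) by (auto simp: enabled_def RD_def)
  moreover have "m (Rise_Fall l) > 0" if "e = Fall l"
    using mg_run_step(3) that assms(2) by (auto simp: enabled_def RD_def)
  ultimately show ?case
    using mg_run_step.IH counts by (auto simp: latch_parity of_bool_def split: if_splits)
qed

lemma RD_left_neighbor_at_fall:
  assumes wf: "wf_circuit c" and run: "mg_run (RD c) (Fall l # t) m" and nb: "(l', l) \<in> neighbors c"
  shows "transp t l' = Opaque" "num (Fall l') t = num (Fall l) t + of_bool (is_Even l)"
proof -
  from run obtain m' where run': "mg_run (RD c) t m'" and en: "enabled (RD c) m' (Fall l)"
    by (rule mg_run_ConsE)
  have l: "l \<in> latches c" and l': "l' \<in> latches c" and parity: "is_Even l' \<longleftrightarrow> is_Odd l"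
    using wf nb by (auto simp: wf_circuit_def neighbors_def latches_def)
  have "m' (Fall_Fall l' l) > 0"
    using en nb by (auto simp: enabled_def RD_def)
  note facts = this RD_Fall_Fall_count[OF run' nb] RD_Fall_RiseL_count[OF run' nb]
    RD_Rise_Fall_count[OF run' l']
  \<comment> \<open>Let F, F' count the falls of \<open>l\<close>, \<open>l'\<close> in
    \<open>t\<close>, R' the rises of \<open>l'\<close>, and let d be 1 if \<open>l'\<close> is odd,
    else 0. The token on \<open>Fall_Fall l' l\<close> gives F + d \<le> F'; the other two places
    give F' \<le> R' + d \<le> F + d. Hence equality throughout, and \<open>Rise_Fall l'\<close> is
    empty.\<close>
  show "num (Fall l') t = num (Fall l) t + of_bool (is_Even l)"
    using facts parity by (auto simp: latch_parity of_bool_def split: if_splits)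
  show "transp t l' = Opaque"
    unfolding RD_opaque_iff[OF run' l']
    using facts parity by (auto simp: latch_parity of_bool_def split: if_splits)
qed

text \<open>An even latch reads its odd left neighbors in the same round, an odd latch its even ones
  in the previous round.\<close>

lemma sync_Suc:
  "sync c st0 (Suc n) l = next_state c (sync c st0 (n + of_bool (is_Even l))) l"
  by (cases l) simp_all

lemma async_opaque_eq_sync:
  assumes "wf_circuit c" "async c st0 t l v" "mg_run (RD c) t m" "transp t l = Opaque"
  shows "v = sync c st0 (num (Fall l) t) l"
  using assms(2-4)
proof (induction arbitrary: m)
  case (async_opaque e t l v)
  from async_opaque.prems(1) obtain m' where "mg_run (RD c) t m'"
    by (rule mg_run_ConsE)
  with async_opaque show ?case by simp
next
  case (async_fall t l st)
  from async_fall.prems(1) obtain m' where run': "mg_run (RD c) t m'"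
    by (rule mg_run_ConsE)
  \<comment> \<open>This is the index at which \<open>sync_Suc\<close> reads left neighbors; the
    opacity of \<open>l'\<close> makes the induction hypothesis applicable.\<close>
  have "st l' = sync c st0 (num (Fall l) t + of_bool (is_Even l)) l'"
    if "l' \<in> left_neighbors c l" for l'
  proof -
    have "(l', l) \<in> neighbors c"
      using that by (simp add: left_neighbors_def)
    note at_fall = RD_left_neighbor_at_fall[OF assms(1) async_fall.prems(1) this]
    from async_fall.IH that run' at_fall(1) have "st l' = sync c st0 (num (Fall l') t) l'"
      by blast
    with at_fall(2) show ?thesis by simp
  qed
  then have "next_state c st l
      = next_state c (sync c st0 (num (Fall l) t + of_bool (is_Even l))) l"
    by (intro next_state_cong) simp_all
  then show ?case by (simp only: sync_Suc count_list.simps) (simp add: sync_Suc)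
qed simp_all

theorem theorem1:
  fixes c :: "('e, 'o) circuit" and st0 :: "('e, 'o) state"
  assumes "wf_circuit c"
  shows "ensures_flow_equivalence (RD c) c st0"
  using async_opaque_eq_sync[OF assms] by (auto simp: ensures_flow_equivalence_def)

end
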